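(* Let $\Gamma:\ell_\infty^+\to\ell_\infty^+$ be an operator which is continuous, monotone, subadditive, homogeneous of degree one, and satisfies $\|\Gamma(\mathbf{1})\|_{\ell_\infty}<\infty$. Then the following statements are equivalent: (i) The spectral radius condition $$r(\Gamma):=\lim_{n\to\infty}\ \sup_{s\in\ell_\infty^+,\ \|s\|_{\ell_\infty}=1}\|\Gamma^n(s)\|_{\ell_\infty}^{1/n}<1.$$ (ii) (Uniform global exponential stability of the discrete-time system $x(k+1)=\Gamma(x(k))$, $k\in\mathbb{N}_0$.) There are $M>0$ and $a\in(0,1)$ such that $\|\Gamma^k(s)\|_{\ell_\infty}\le Ma^k\|s\|_{\ell_\infty}$ for all $s\in\ell_\infty^+$ and $k\in\mathbb{N}_0$. (iii) (Uniform global asymptotic stability of the same system.) There is $\beta\in\mathcal{KL}$ such that $\|\Gamma^k(s)\|_{\ell_\infty}\le\beta(\|s\|_{\ell_\infty},k)$ for all $s\in\ell_\infty^+$ and $k\in\mathbb{N}_0$. (iv) (There is a point of strict decay.) There are $\lambda\in(0,1)$ and $s^0\in\mathrm{int}(\ell_\infty^+)$ such that $\Gamma(s^0)\le\lambda s^0$. (v) $\|\Gamma^n(\mathbf{1})\|_{\ell_\infty}<1$ for some $n\in\mathbb{N}$.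
   Context: $\ell_\infty$ is the Banach space of bounded real sequences $x=(x_i)_{i\in\mathbb{N}}$ with norm $\|x\|_{\ell_\infty}=\sup_i|x_i|$; $\ell_\infty^+$ is the cone of sequences in $\ell_\infty$ with all $x_i\ge0$; $\mathrm{int}(\ell_\infty^+)$ is its interior in $\ell_\infty$; $x\le y$ means $x_i\le y_i$ for all $i$; $\mathbf{1}=(1,1,1,\ldots)$. $\mathbb{N}$ denotes the positive integers and $\mathbb{N}_0=\mathbb{N}\cup\{0\}$. $\Gamma^n$ denotes the $n$-fold composition of $\Gamma$ (with $\Gamma^0=\mathrm{id}$). An operator $\Gamma:\ell_\infty^+\to\ell_\infty^+$ is *monotone* if $\Gamma(r)\le\Gamma(s)$ for all $r,s\in\ell_\infty^+$ with $r\le s$; *homogeneous of degree one* if $\Gamma(cs)=c\Gamma(s)$ for all $s\in\ell_\infty^+$ and $c\ge0$; *subadditive* if $\Gamma(r+s)\le\Gamma(r)+\Gamma(s)$ for all $r,s\in\ell_\infty^+$. $\mathcal{KL}$ is the set of continuous $\beta:\mathbb{R}_+\times\mathbb{R}_+\to\mathbb{R}_+$ such that $\beta(\cdot,t)$ is strictly increasing with $\beta(0,t)=0$ for each $t\ge0$, and $\beta(r,\cdot)$ is strictly decreasing to $0$ for each $r>0$. *)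

theory Defs
  imports "HOL-Analysis.Analysis"
begin

text \<open>
  Since \<^typ>\<open>nat\<close> carries the discrete topology, every sequence is continuous, and the bounded
  continuous functions on \<^typ>\<open>nat\<close> under the supremum norm are the Banach space of all bounded
  real sequences. Positions are numbered from 0 instead of from 1.
\<close>

type_synonym linf = "nat \<Rightarrow>\<^sub>C real"

text \<open>The library provides no order on \<^typ>\<open>linf\<close>.\<close>

definition seq_le :: "linf \<Rightarrow> linf \<Rightarrow> bool"  (infix \<open>\<preceq>\<close> 50)
  where "x \<preceq> y \<longleftrightarrow> (\<forall>i. apply_bcontfun x i \<le> apply_bcontfun y i)"

definition linf_pos :: "linf set"
  where "linf_pos = {x. \<forall>i. 0 \<le> apply_bcontfun x i}"

definition ones :: linf
  where "ones = const_bcontfun 1"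

text \<open>
  An operator on the cone is a total function on \<^typ>\<open>linf\<close> that maps the cone into itself;
  its values off the cone are never referred to.
\<close>

definition monotone_op :: "(linf \<Rightarrow> linf) \<Rightarrow> bool"
  where "monotone_op \<Gamma> \<longleftrightarrow> (\<forall>r\<in>linf_pos. \<forall>s\<in>linf_pos. r \<preceq> s \<longrightarrow> \<Gamma> r \<preceq> \<Gamma> s)"

definition homogeneous_op :: "(linf \<Rightarrow> linf) \<Rightarrow> bool"
  where "homogeneous_op \<Gamma> \<longleftrightarrow> (\<forall>s\<in>linf_pos. \<forall>c\<ge>0. \<Gamma> (c *\<^sub>R s) = c *\<^sub>R \<Gamma> s)"

definition subadditive_op :: "(linf \<Rightarrow> linf) \<Rightarrow> bool"
  where "subadditive_op \<Gamma> \<longleftrightarrow> (\<forall>r\<in>linf_pos. \<forall>s\<in>linf_pos. \<Gamma> (r + s) \<preceq> \<Gamma> r + \<Gamma> s)"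

text \<open>
  For monotone homogeneous operators the supremum is over a bounded set, since a unit vector of the
  cone lies below \<^const>\<open>ones\<close>. The term with index 0 is irrelevant for the limit.
\<close>

definition growth_seq :: "(linf \<Rightarrow> linf) \<Rightarrow> nat \<Rightarrow> real"
  where "growth_seq \<Gamma> n = (SUP s\<in>{s \<in> linf_pos. norm s = 1}. norm ((\<Gamma> ^^ n) s) powr (1 / real n))"

definition spectral_radius :: "(linf \<Rightarrow> linf) \<Rightarrow> real"
  where "spectral_radius \<Gamma> = lim (growth_seq \<Gamma>)"

text \<open>
  Functions of class KL on the nonnegative quadrant; as above, values outside of it do not matter.
\<close>

definition class_KL :: "(real \<Rightarrow> real \<Rightarrow> real) set"
  where "class_KL = {\<beta>.
    (\<forall>r\<ge>0. \<forall>t\<ge>0. 0 \<le> \<beta> r t) \<and>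
    continuous_on ({0..} \<times> {0..}) (\<lambda>(r, t). \<beta> r t) \<and>
    (\<forall>t\<ge>0. strict_mono_on {0..} (\<lambda>r. \<beta> r t) \<and> \<beta> 0 t = 0) \<and>
    (\<forall>r>0. strict_antimono_on {0..} (\<beta> r) \<and> (\<beta> r \<longlongrightarrow> 0) at_top)}"

text \<open>Stability of the system \<open>x(k+1) = \<Gamma>(x(k))\<close>, whose trajectory from \<open>s\<close> is \<open>\<Gamma>\<^sup>k s\<close>.\<close>

definition UGES :: "(linf \<Rightarrow> linf) \<Rightarrow> bool"
  where "UGES \<Gamma> \<longleftrightarrow> (\<exists>M>0. \<exists>a\<in>{0<..<1}. \<forall>s\<in>linf_pos. \<forall>k::nat.
    norm ((\<Gamma> ^^ k) s) \<le> M * a ^ k * norm s)"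

definition UGAS :: "(linf \<Rightarrow> linf) \<Rightarrow> bool"
  where "UGAS \<Gamma> \<longleftrightarrow> (\<exists>\<beta>\<in>class_KL. \<forall>s\<in>linf_pos. \<forall>k::nat.
    norm ((\<Gamma> ^^ k) s) \<le> \<beta> (norm s) (real k))"

definition point_of_strict_decay :: "(linf \<Rightarrow> linf) \<Rightarrow> bool"
  where "point_of_strict_decay \<Gamma> \<longleftrightarrow>
    (\<exists>c\<in>{0<..<1}. \<exists>s\<^sub>0\<in>interior linf_pos. \<Gamma> s\<^sub>0 \<preceq> c *\<^sub>R s\<^sub>0)"

end

theory Submission
  imports Defs
begin

text \<open>
  Everything is governed by the single scalar sequence \<open>u n = \<parallel>\<Gamma>\<^sup>n(\<one>)\<parallel>\<close>. A point \<open>s\<close> of the cone satisfies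
  \<open>s \<le> \<parallel>s\<parallel> \<one>\<close>, so monotonicity and homogeneity of the iterates give \<open>\<parallel>\<Gamma>\<^sup>n(s)\<parallel> \<le> u n \<parallel>s\<parallel>\<close>, with equality
  at \<open>s = \<one>\<close>. Three consequences follow: the growth sequence is \<open>n \<mapsto> (u n)\<^bsup>1/n\<^esup>\<close>, the sequence \<open>u\<close> is
  submultiplicative, and an exponential or KL bound along all trajectories amounts to one on \<open>u\<close>.

  For a nonnegative submultiplicative sequence, \<open>u m \<le> c\<^sup>m\<close> at one positive index \<open>m\<close> forces
  \<open>u n \<le> M c\<^sup>n\<close> at all indices (\<open>submultiplicative_geometric_bound\<close>). This yields Fekete's theorem, that
  the roots converge to their infimum, and it turns \<open>u n < 1\<close> for one \<open>n\<close> into exponential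
  stability. Conversely each of the conditions makes \<open>u\<close> drop below 1 somewhere; for a point \<open>s\<^sub>0\<close> of
  strict decay this is because \<open>s\<^sub>0\<close>, being interior, dominates a positive multiple of \<open>\<one>\<close>.

  Subadditivity enters in the construction of a point of strict decay. If \<open>u n \<le> c\<^sup>n\<close> with
  \<open>0 < c < 1\<close> and \<open>n \<ge> 1\<close>, put \<open>s\<^sub>0 = \<Sum>k<n. c\<^bsup>-k\<^esup> \<Gamma>\<^sup>k(\<one>)\<close>, a truncation of the resolvent series of \<open>\<Gamma>\<close> at
  \<open>c\<close>. By subadditivity \<open>\<Gamma>(s\<^sub>0)\<close> is at most \<open>c\<close> times the sum shifted by one index; the new last term
  \<open>c\<^bsup>-n\<^esup> \<Gamma>\<^sup>n(\<one>)\<close> is at most the lost first term \<open>\<one>\<close>, whence \<open>\<Gamma>(s\<^sub>0) \<le> c s\<^sub>0\<close>.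
\<close>

section \<open>Submultiplicative sequences\<close>

text \<open>
  Strip off blocks of length \<open>m\<close>, each costing a factor at most \<open>c\<^sup>m\<close>, until fewer than \<open>m\<close> steps
  remain; the constant absorbs the finitely many possible remainders.
\<close>

lemma submultiplicative_geometric_bound:
  fixes u :: "nat \<Rightarrow> real"
  assumes nonneg: "\<And>n. 0 \<le> u n" and submult: "\<And>m n. u (m + n) \<le> u m * u n"
    and "m \<ge> 1" "0 < c" "u m \<le> c ^ m"
  shows "\<exists>M>0. \<forall>n. u n \<le> M * c ^ n"
proof -
  define M where "M = 1 + (\<Sum>r<m. u r / c ^ r)"
  have "M > 0"
    unfolding M_def using nonneg \<open>0 < c\<close> by (intro add_pos_nonneg sum_nonneg) auto
  have "u n \<le> M * c ^ n" for n
  proof (induction n rule: less_induct)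
    case (less n)
    show ?case
    proof (cases "n < m")
      case True
      have "u n / c ^ n \<le> (\<Sum>r<m. u r / c ^ r)"
        using nonneg \<open>0 < c\<close> True by (intro member_le_sum) auto
      then have "u n / c ^ n \<le> M"
        by (simp add: M_def)
      with \<open>0 < c\<close> show ?thesis
        by (simp add: pos_divide_le_eq)
    next
      case False
      have "u n \<le> u m * u (n - m)"
        using submult[of m "n - m"] False by simp
      also have "\<dots> \<le> c ^ m * (M * c ^ (n - m))"
        using less.IH[of "n - m"] False \<open>m \<ge> 1\<close> \<open>u m \<le> c ^ m\<close> \<open>0 < c\<close> nonneg by (intro mult_mono) auto
      also have "\<dots> = M * c ^ n"
        using False by (simp flip: power_add)
      finally show ?thesis .
    qed
  qed
  with \<open>M > 0\<close> show ?thesis by blast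
qed

lemma tendsto_root_geometric:
  fixes M c :: real
  assumes "0 < M" "0 < c"
  shows "(\<lambda>n. root n (M * c ^ n)) \<longlonglongrightarrow> c"
proof -
  have "(\<lambda>n. root n M * c) \<longlonglongrightarrow> 1 * c"
    by (intro tendsto_intros LIMSEQ_root_const assms)
  moreover have "\<forall>\<^sub>F n in sequentially. root n M * c = root n (M * c ^ n)"
    using eventually_gt_at_top[of 0]
    by eventually_elim (use assms in \<open>simp add: real_root_mult real_root_power_cancel\<close>)
  ultimately show ?thesis
    using tendsto_cong by fastforce
qed

text \<open>
  Fekete's theorem in multiplicative form. Working with geometric bounds instead of logarithms also
  covers sequences with zeros.
\<close>

lemma submultiplicative_root_tendsto:
  fixes u :: "nat \<Rightarrow> real"
  assumes nonneg: "\<And>n. 0 \<le> u n" and submult: "\<And>m n. u (m + n) \<le> u m * u n"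
  shows "(\<lambda>n. root n (u n)) \<longlonglongrightarrow> (INF n\<in>{1..}. root n (u n))" (is "_ \<longlonglongrightarrow> ?L")
proof (rule order_tendstoI)
  have bdd: "bdd_below ((\<lambda>n. root n (u n)) ` {1..})"
    using nonneg by (intro bdd_belowI[of _ 0]) auto
  have "0 \<le> ?L"
    using nonneg by (intro cINF_greatest) auto
  fix x
  show "\<forall>\<^sub>F n in sequentially. x < root n (u n)" if "x < ?L"
    using eventually_ge_at_top[of 1]
  proof eventually_elim
    case (elim n)
    then have "?L \<le> root n (u n)"
      by (intro cINF_lower[OF bdd]) auto
    with that show ?case by simp
  qed
  show "\<forall>\<^sub>F n in sequentially. root n (u n) < x" if "?L < x"
  proof -
    obtain c where c: "?L < c" "c < x"
      using dense \<open>?L < x\<close> by blast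
    with \<open>0 \<le> ?L\<close> have "0 < c" by linarith
    obtain m where m: "m \<ge> 1" "root m (u m) < c"
      using c(1) bdd by (auto simp: cINF_less_iff)
    have "u m = root m (u m) ^ m"
      using m nonneg by (simp add: real_root_pow_pos2)
    also have "\<dots> \<le> c ^ m"
      using m nonneg by (intro power_mono) auto
    finally obtain M where M: "M > 0" "\<And>n. u n \<le> M * c ^ n"
      using submultiplicative_geometric_bound[OF nonneg submult \<open>m \<ge> 1\<close> \<open>0 < c\<close>] by blast
    have "\<forall>\<^sub>F n in sequentially. root n (M * c ^ n) < x"
      using order_tendstoD(2)[OF tendsto_root_geometric] M c \<open>0 < c\<close> by blast
    then show ?thesis
      using eventually_gt_at_top[of 0]
    proof eventually_elim
      case (elim n)
      then have "root n (u n) \<le> root n (M * c ^ n)"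
        using M by (intro real_root_le_mono) auto
      then show ?case
        using elim(1) by (rule le_less_trans)
    qed
  qed
qed

section \<open>Order and norm on the cone\<close>

lemma linf_pos_closed:
  shows linf_pos_0: "0 \<in> linf_pos"
    and linf_pos_ones: "ones \<in> linf_pos"
    and linf_pos_add: "x \<in> linf_pos \<Longrightarrow> y \<in> linf_pos \<Longrightarrow> x + y \<in> linf_pos"
    and linf_pos_scaleR: "0 \<le> c \<Longrightarrow> x \<in> linf_pos \<Longrightarrow> c *\<^sub>R x \<in> linf_pos"
  by (auto simp: linf_pos_def ones_def)

lemma linf_pos_sum: "(\<And>k. k \<in> A \<Longrightarrow> f k \<in> linf_pos) \<Longrightarrow> sum f A \<in> linf_pos"
  by (induction A rule: infinite_finite_induct) (auto intro: linf_pos_0 linf_pos_add)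

lemma seq_le_trans: "x \<preceq> y \<Longrightarrow> y \<preceq> z \<Longrightarrow> x \<preceq> z"
  unfolding seq_le_def using order_trans by blast

lemma seq_le_scaleR: "0 \<le> c \<Longrightarrow> x \<preceq> y \<Longrightarrow> c *\<^sub>R x \<preceq> c *\<^sub>R y"
  by (simp add: seq_le_def mult_left_mono)

lemma seq_le_add: "x \<preceq> y \<Longrightarrow> x' \<preceq> y' \<Longrightarrow> x + x' \<preceq> y + y'"
  by (simp add: seq_le_def add_mono)

lemma seq_le_norm_ones: "x \<preceq> norm x *\<^sub>R ones"
  using norm_bounded[of x] by (auto simp: seq_le_def ones_def abs_le_iff)

lemma norm_seq_le: "x \<in> linf_pos \<Longrightarrow> x \<preceq> y \<Longrightarrow> norm x \<le> norm y"
proof (rule norm_bound)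
  fix i assume "x \<in> linf_pos" "x \<preceq> y"
  then have "norm (apply_bcontfun x i) \<le> norm (apply_bcontfun y i)"
    by (smt (verit) linf_pos_def mem_Collect_eq real_norm_def seq_le_def)
  also have "\<dots> \<le> norm y" by (rule norm_bounded)
  finally show "norm (apply_bcontfun x i) \<le> norm y" .
qed

lemma norm_ones: "norm ones = 1"
proof (rule antisym)
  show "norm ones \<le> 1" by (rule norm_bound) (simp add: ones_def)
  show "1 \<le> norm ones" using norm_bounded[of ones 0] by (simp add: ones_def)
qed

lemma interior_linf_pos_if_above_ones:
  assumes "0 < \<epsilon>" "\<epsilon> *\<^sub>R ones \<preceq> x"
  shows "x \<in> interior linf_pos"
proof (rule interiorI)
  show "ball x \<epsilon> \<subseteq> linf_pos"
  proof
    fix y assume "y \<in> ball x \<epsilon>"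
    then have "norm (x - y) < \<epsilon>" by (simp add: dist_norm)
    then have "apply_bcontfun x i - apply_bcontfun y i < \<epsilon>" for i
      using norm_bounded[of "x - y" i] by (simp add: abs_le_iff)
    moreover have "\<epsilon> \<le> apply_bcontfun x i" for i
      using assms by (auto simp: seq_le_def ones_def)
    ultimately show "y \<in> linf_pos"
      unfolding linf_pos_def by (smt (verit) mem_Collect_eq)
  qed
qed (use assms in auto)

text \<open>Moving a little from an interior point in the direction \<open>-\<one>\<close> stays in the cone.\<close>

lemma interior_linf_pos_above_ones:
  assumes "x \<in> interior linf_pos"
  obtains \<epsilon> where "0 < \<epsilon>" "\<epsilon> *\<^sub>R ones \<preceq> x"
proof -
  obtain e where e: "e > 0" "cball x e \<subseteq> linf_pos"
    using assms by (meson mem_interior_cball)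
  then have "x - e *\<^sub>R ones \<in> linf_pos"
    by (auto simp: dist_norm norm_ones)
  then have "e *\<^sub>R ones \<preceq> x"
    by (simp add: linf_pos_def seq_le_def)
  with e that show thesis by blast
qed

section \<open>Monotone homogeneous operators\<close>

locale monotone_homogeneous =
  fixes \<Gamma> :: "linf \<Rightarrow> linf"
  assumes maps: "\<Gamma> \<in> linf_pos \<rightarrow> linf_pos"
    and mono: "monotone_op \<Gamma>"
    and homogeneous: "homogeneous_op \<Gamma>"
begin

lemma in_cone: "s \<in> linf_pos \<Longrightarrow> \<Gamma> s \<in> linf_pos"
  using maps by blast

lemma apply_mono: "r \<in> linf_pos \<Longrightarrow> s \<in> linf_pos \<Longrightarrow> r \<preceq> s \<Longrightarrow> \<Gamma> r \<preceq> \<Gamma> s"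
  using mono by (simp add: monotone_op_def)

lemma apply_scaleR: "s \<in> linf_pos \<Longrightarrow> 0 \<le> c \<Longrightarrow> \<Gamma> (c *\<^sub>R s) = c *\<^sub>R \<Gamma> s"
  using homogeneous by (simp add: homogeneous_op_def)

lemma apply_zero: "\<Gamma> 0 = 0"
  using apply_scaleR[of 0 0] by (simp add: linf_pos_0)

text \<open>On the part of the cone in the unit ball, \<open>\<Gamma>\<close> is largest at the greatest element \<open>\<one>\<close>.\<close>

lemma norm_apply_le:
  assumes "s \<in> linf_pos"
  shows "norm (\<Gamma> s) \<le> norm (\<Gamma> ones) * norm s"
proof -
  have "\<Gamma> s \<preceq> norm s *\<^sub>R \<Gamma> ones"
    using assms apply_mono[of s "norm s *\<^sub>R ones"] seq_le_norm_ones[of s]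
    by (simp add: linf_pos_ones linf_pos_scaleR apply_scaleR)
  then have "norm (\<Gamma> s) \<le> norm (norm s *\<^sub>R \<Gamma> ones)"
    using norm_seq_le in_cone assms by blast
  then show ?thesis by (simp add: mult.commute)
qed

text \<open>
  Monotonicity and homogeneity are stable under composition, so the estimates for \<open>\<Gamma>\<close> in this context
  hold for each power of \<open>\<Gamma>\<close> without further induction.
\<close>

lemma iterate: "monotone_homogeneous (\<Gamma> ^^ n)"
proof (induction n)
  case 0
  show ?case by unfold_locales (auto simp: monotone_op_def homogeneous_op_def)
next
  case (Suc n)
  then interpret it: monotone_homogeneous "\<Gamma> ^^ n" .
  show ?case
    by unfold_locales
      (auto simp: monotone_op_def homogeneous_op_def in_cone it.in_cone
        apply_scaleR it.apply_scaleR intro!: apply_mono it.apply_mono)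
qed

definition ones_growth :: "nat \<Rightarrow> real"
  where "ones_growth n = norm ((\<Gamma> ^^ n) ones)"

lemma ones_growth_nonneg: "0 \<le> ones_growth n"
  by (simp add: ones_growth_def)

lemma norm_iterate_le: "s \<in> linf_pos \<Longrightarrow> norm ((\<Gamma> ^^ n) s) \<le> ones_growth n * norm s"
  unfolding ones_growth_def by (rule monotone_homogeneous.norm_apply_le[OF iterate])

lemma ones_growth_submult: "ones_growth (m + n) \<le> ones_growth m * ones_growth n"
  using norm_iterate_le[of "(\<Gamma> ^^ n) ones" m] monotone_homogeneous.in_cone[OF iterate linf_pos_ones]
  by (simp add: ones_growth_def funpow_add)

text \<open>
  The supremum is attained at \<open>\<one>\<close>. Index 0 is excluded because \<open>root 0 x = 0\<close>, whereas the growth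
  sequence starts with \<open>1 powr 0 = 1\<close>.
\<close>

lemma growth_seq_eq_root:
  assumes "n \<ge> 1"
  shows "growth_seq \<Gamma> n = root n (ones_growth n)"
proof -
  have "growth_seq \<Gamma> n = norm ((\<Gamma> ^^ n) ones) powr (1 / real n)"
    unfolding growth_seq_def
  proof (rule cSup_eq_maximum)
    fix y assume "y \<in> (\<lambda>s. norm ((\<Gamma> ^^ n) s) powr (1 / real n)) ` {s \<in> linf_pos. norm s = 1}"
    then show "y \<le> norm ((\<Gamma> ^^ n) ones) powr (1 / real n)"
      using norm_iterate_le[of _ n] by (force simp: ones_growth_def intro!: powr_mono2)
  qed (auto simp: linf_pos_ones norm_ones)
  also have "\<dots> = root n (norm ((\<Gamma> ^^ n) ones))"
    using assms by (cases "(\<Gamma> ^^ n) ones = 0") (auto simp: root_powr_inverse)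
  finally show ?thesis by (simp add: ones_growth_def)
qed

lemma growth_seq_tendsto: "growth_seq \<Gamma> \<longlonglongrightarrow> (INF n\<in>{1..}. root n (ones_growth n))"
proof -
  have "\<forall>\<^sub>F n in sequentially. root n (ones_growth n) = growth_seq \<Gamma> n"
    using eventually_ge_at_top[of 1] by eventually_elim (simp add: growth_seq_eq_root)
  with submultiplicative_root_tendsto[of ones_growth, OF ones_growth_nonneg ones_growth_submult]
  show ?thesis using tendsto_cong by fastforce
qed

section \<open>Equivalence of the stability conditions\<close>

lemma spectral_radius_eq_INF: "spectral_radius \<Gamma> = (INF n\<in>{1..}. root n (ones_growth n))"
  unfolding spectral_radius_def using growth_seq_tendsto by (rule limI)

text \<open>
  The spectral radius is an infimum, not only a limit, so one index \<open>n\<close> decides whether it is below 1.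
\<close>

lemma spectral_radius_less_1_iff: "spectral_radius \<Gamma> < 1 \<longleftrightarrow> (\<exists>n\<ge>1. ones_growth n < 1)"
proof -
  have "bdd_below ((\<lambda>n. root n (ones_growth n)) ` {1..})"
    using ones_growth_nonneg by (intro bdd_belowI[of _ 0]) auto
  then have "spectral_radius \<Gamma> < 1 \<longleftrightarrow> (\<exists>n\<in>{1..}. root n (ones_growth n) < 1)"
    unfolding spectral_radius_eq_INF by (subst cINF_less_iff) auto
  then show ?thesis by auto
qed

text \<open>The maximum with \<open>1/2\<close> keeps the rate positive when the iterate vanishes.\<close>

lemma contraction_rate:
  assumes "n \<ge> 1" "ones_growth n < 1"
  obtains c where "0 < c" "c < 1" "ones_growth n \<le> c ^ n"
proof
  let ?c = "root n (max (ones_growth n) (1/2))"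
  show "0 < ?c" "?c < 1" using assms by auto
  have "?c ^ n = max (ones_growth n) (1/2)"
    using assms by (intro real_root_pow_pos2) auto
  then show "ones_growth n \<le> ?c ^ n" by simp
qed

lemma UGES_if_ones_growth:
  assumes "n \<ge> 1" "ones_growth n < 1"
  shows "UGES \<Gamma>"
proof -
  obtain c where c: "0 < c" "c < 1" "ones_growth n \<le> c ^ n"
    using contraction_rate assms by blast
  obtain M where M: "M > 0" "\<And>k. ones_growth k \<le> M * c ^ k"
    using submultiplicative_geometric_bound[OF ones_growth_nonneg ones_growth_submult assms(1) c(1,3)]
    by blast
  have "norm ((\<Gamma> ^^ k) s) \<le> M * c ^ k * norm s" if "s \<in> linf_pos" for s k
    using norm_iterate_le[OF that] M by (meson mult_right_mono norm_ge_zero order_trans)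
  with M(1) c show ?thesis unfolding UGES_def by (meson greaterThanLessThan_iff)
qed

text \<open>
  The factor \<open>a powr t\<close> extends \<open>a ^ k\<close> to real times; \<open>a > 0\<close> makes the decay strict in \<open>t\<close>.
\<close>

lemma exponential_in_class_KL:
  fixes M a :: real
  assumes "M > 0" "0 < a" "a < 1"
  shows "(\<lambda>r t. M * r * a powr t) \<in> class_KL"
proof -
  have "continuous_on ({0..} \<times> {0..}) (\<lambda>(r, t). M * r * a powr t)"
    unfolding case_prod_beta using assms by (intro continuous_intros) auto
  moreover have "((\<lambda>t. M * r * a powr t) \<longlongrightarrow> 0) at_top" for r
  proof -
    have "LIM t at_top. ln a * t :> at_bot"
      using assms by (intro filterlim_tendsto_neg_mult_at_bot[OF tendsto_const] filterlim_ident) auto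
    then have "((\<lambda>t. a powr t) \<longlongrightarrow> 0) at_top"
      using assms by (auto simp: powr_def mult.commute intro: filterlim_compose[OF exp_at_bot])
    from tendsto_mult_right_zero[OF this] show ?thesis .
  qed
  ultimately show ?thesis
    using assms unfolding class_KL_def
    by (auto simp: monotone_on_def powr_less_mono')
qed

lemma UGAS_if_UGES: "UGAS \<Gamma>" if UGES: "UGES \<Gamma>"
proof -
  obtain M a where Ma: "M > 0" "0 < a" "a < 1"
    and bound: "\<And>s k. s \<in> linf_pos \<Longrightarrow> norm ((\<Gamma> ^^ k) s) \<le> M * a ^ k * norm s"
    using UGES by (auto simp: UGES_def)
  then have "norm ((\<Gamma> ^^ k) s) \<le> M * norm s * a powr real k" if "s \<in> linf_pos" for s k
    using bound[OF that, of k] by (simp add: powr_realpow mult_ac)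
  with exponential_in_class_KL[OF Ma] show ?thesis
    unfolding UGAS_def by (intro bexI[where x = "\<lambda>r t. M * r * a powr t"]) auto
qed

lemma ones_growth_less_1_if_tendsto_0:
  assumes "f \<longlonglongrightarrow> 0" "\<And>k. ones_growth k \<le> f k"
  shows "\<exists>n\<ge>1. ones_growth n < 1"
proof -
  have "\<forall>\<^sub>F k in sequentially. f k < 1"
    using assms(1) by (rule order_tendstoD) simp
  with eventually_ge_at_top[of 1] have "\<forall>\<^sub>F k in sequentially. k \<ge> 1 \<and> f k < 1"
    by eventually_elim simp
  then obtain k where "k \<ge> 1" "f k < 1"
    using eventually_happens by fastforce
  with assms(2) show ?thesis
    using le_less_trans by blast
qed

lemma ones_growth_if_UGAS: "\<exists>n\<ge>1. ones_growth n < 1" if UGAS: "UGAS \<Gamma>"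
proof -
  obtain \<beta> where \<beta>: "\<beta> \<in> class_KL"
    and bound: "\<And>s k. s \<in> linf_pos \<Longrightarrow> norm ((\<Gamma> ^^ k) s) \<le> \<beta> (norm s) (real k)"
    using UGAS by (auto simp: UGAS_def)
  have "(\<beta> 1 \<longlongrightarrow> 0) at_top" using \<beta> by (simp add: class_KL_def)
  then have "(\<lambda>k. \<beta> 1 (real k)) \<longlonglongrightarrow> 0"
    by (rule filterlim_compose[OF _ filterlim_real_sequentially])
  moreover have "ones_growth k \<le> \<beta> 1 (real k)" for k
    using bound[OF linf_pos_ones] by (simp add: norm_ones ones_growth_def)
  ultimately show ?thesis by (rule ones_growth_less_1_if_tendsto_0)
qed

text \<open>
  Iterating \<open>\<Gamma>(s\<^sub>0) \<le> c s\<^sub>0\<close> gives \<open>\<Gamma>\<^sup>k(s\<^sub>0) \<le> c\<^sup>k s\<^sub>0\<close>, and the decay transfers to \<open>\<one>\<close> because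
  \<open>\<epsilon> \<one> \<le> s\<^sub>0\<close> for some \<open>\<epsilon> > 0\<close>.
\<close>

lemma ones_growth_if_strict_decay:
  assumes "point_of_strict_decay \<Gamma>"
  shows "\<exists>n\<ge>1. ones_growth n < 1"
proof -
  obtain c s where c: "0 < c" "c < 1" and s: "s \<in> interior linf_pos" and decay: "\<Gamma> s \<preceq> c *\<^sub>R s"
    using assms by (auto simp: point_of_strict_decay_def)
  have pos: "s \<in> linf_pos" using s interior_subset by blast
  have it_decay: "(\<Gamma> ^^ k) s \<preceq> c ^ k *\<^sub>R s" for k
  proof (induction k)
    case 0
    show ?case by (simp add: seq_le_def)
  next
    case (Suc k)
    have "\<Gamma> ((\<Gamma> ^^ k) s) \<preceq> \<Gamma> (c ^ k *\<^sub>R s)"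
      using Suc c pos monotone_homogeneous.in_cone[OF iterate]
      by (intro apply_mono linf_pos_scaleR) auto
    also have "\<Gamma> (c ^ k *\<^sub>R s) = c ^ k *\<^sub>R \<Gamma> s"
      using c pos by (simp add: apply_scaleR)
    finally have "(\<Gamma> ^^ Suc k) s \<preceq> c ^ k *\<^sub>R \<Gamma> s" by simp
    moreover have "c ^ k *\<^sub>R \<Gamma> s \<preceq> c ^ Suc k *\<^sub>R s"
      using seq_le_scaleR[OF _ decay, of "c ^ k"] c by (simp add: mult.commute)
    ultimately show ?case by (rule seq_le_trans)
  qed
  obtain \<epsilon> where \<epsilon>: "0 < \<epsilon>" "\<epsilon> *\<^sub>R ones \<preceq> s"
    using interior_linf_pos_above_ones s by blast
  have "ones_growth k \<le> norm s / \<epsilon> * c ^ k" for k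
  proof -
    interpret it: monotone_homogeneous "\<Gamma> ^^ k" by (rule iterate)
    have "\<epsilon> *\<^sub>R (\<Gamma> ^^ k) ones \<preceq> (\<Gamma> ^^ k) s"
      using it.apply_mono[OF _ pos \<epsilon>(2)] \<epsilon>(1)
      by (simp add: linf_pos_scaleR linf_pos_ones it.apply_scaleR)
    from seq_le_trans[OF this it_decay]
    have "norm (\<epsilon> *\<^sub>R (\<Gamma> ^^ k) ones) \<le> norm (c ^ k *\<^sub>R s)"
      using \<epsilon>(1) by (intro norm_seq_le linf_pos_scaleR it.in_cone linf_pos_ones) auto
    with \<epsilon>(1) c show ?thesis by (simp add: ones_growth_def field_simps)
  qed
  moreover have "(\<lambda>k. norm s / \<epsilon> * c ^ k) \<longlonglongrightarrow> 0"
    using c by (intro tendsto_mult_right_zero LIMSEQ_power_zero) auto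
  ultimately show ?thesis using ones_growth_less_1_if_tendsto_0 by blast
qed

lemma apply_sum_seq_le:
  assumes "subadditive_op \<Gamma>" "finite A" "\<And>k. k \<in> A \<Longrightarrow> f k \<in> linf_pos"
  shows "\<Gamma> (sum f A) \<preceq> (\<Sum>k\<in>A. \<Gamma> (f k))"
  using assms(2,3)
proof (induction A rule: finite_induct)
  case empty
  show ?case by (simp add: apply_zero seq_le_def)
next
  case (insert k A)
  have "\<Gamma> (f k + sum f A) \<preceq> \<Gamma> (f k) + \<Gamma> (sum f A)"
    using assms(1) insert.prems by (simp add: subadditive_op_def linf_pos_sum)
  moreover have "\<Gamma> (f k) + \<Gamma> (sum f A) \<preceq> \<Gamma> (f k) + (\<Sum>k\<in>A. \<Gamma> (f k))"
    using insert by (intro seq_le_add) (auto simp: seq_le_def)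
  ultimately show ?case
    using insert.hyps by (auto intro: seq_le_trans)
qed

text \<open>
  The point of strict decay is the resolvent series \<open>\<Sum>k. c\<^bsup>-k\<^esup> \<Gamma>\<^sup>k(\<one>)\<close>, cut off at an index
  where \<open>c\<^bsup>-n\<^esup> \<Gamma>\<^sup>n(\<one>) \<le> \<one>\<close>. The summand \<open>\<one>\<close> for \<open>k = 0\<close> puts it in the interior and compensates for the
  summand that \<open>\<Gamma>\<close> pushes beyond the cut.
\<close>

lemma strict_decay_if_ones_growth:
  assumes subadd: "subadditive_op \<Gamma>" and n: "n \<ge> 1" "ones_growth n < 1"
  shows "point_of_strict_decay \<Gamma>"
proof -
  obtain c where c: "0 < c" "c < 1" "ones_growth n \<le> c ^ n"
    using contraction_rate n by blast
  define f where "f k = (1 / c ^ k) *\<^sub>R (\<Gamma> ^^ k) ones" for k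
  define s where "s = sum f {..<n}"
  have it_pos: "(\<Gamma> ^^ k) ones \<in> linf_pos" for k
    by (rule monotone_homogeneous.in_cone[OF iterate linf_pos_ones])
  have f_pos: "f k \<in> linf_pos" for k
    using c it_pos by (simp add: f_def linf_pos_scaleR)
  have \<Gamma>_f: "\<Gamma> (f k) = c *\<^sub>R f (Suc k)" for k
    using c it_pos by (simp add: f_def apply_scaleR)
  have f_0: "f 0 = ones" by (simp add: f_def)
  have f_n: "f n \<preceq> f 0"
  proof -
    have "(\<Gamma> ^^ n) ones \<preceq> c ^ n *\<^sub>R ones"
      using seq_le_norm_ones[of "(\<Gamma> ^^ n) ones"] c(3)
      by (auto simp: seq_le_def ones_growth_def ones_def intro: order_trans)
    from seq_le_scaleR[OF _ this, of "1 / c ^ n"] c(1) show ?thesis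
      by (simp add: f_def)
  qed
  have "s + f n = f 0 + (\<Sum>k<n. f (Suc k))"
    unfolding s_def by (metis sum.lessThan_Suc sum.lessThan_Suc_shift)
  then have "(\<Sum>k<n. f (Suc k)) = s + f n - f 0"
    by (simp add: algebra_simps)
  then have "(\<Sum>k<n. f (Suc k)) \<preceq> s"
    using f_n by (simp add: seq_le_def)
  moreover have "\<Gamma> s \<preceq> c *\<^sub>R (\<Sum>k<n. f (Suc k))"
    using apply_sum_seq_le[OF subadd, of "{..<n}" f] f_pos
    by (simp add: s_def \<Gamma>_f scaleR_sum_right)
  ultimately have "\<Gamma> s \<preceq> c *\<^sub>R s"
    using c seq_le_scaleR seq_le_trans by (meson less_imp_le)
  moreover have "s \<in> interior linf_pos"
  proof (rule interior_linf_pos_if_above_ones)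
    obtain m where "n = Suc m" using n by (cases n) auto
    then have "s = ones + (\<Sum>k<m. f (Suc k))"
      by (simp add: s_def sum.lessThan_Suc_shift f_0 del: sum.lessThan_Suc)
    moreover have "(\<Sum>k<m. f (Suc k)) \<in> linf_pos"
      using f_pos by (rule linf_pos_sum)
    ultimately show "1 *\<^sub>R ones \<preceq> s"
      by (simp add: seq_le_def linf_pos_def)
  qed simp
  ultimately show ?thesis
    using c unfolding point_of_strict_decay_def by (meson greaterThanLessThan_iff)
qed

end

theorem proposition9:
  fixes \<Gamma> :: "linf \<Rightarrow> linf"
  assumes "\<Gamma> \<in> linf_pos \<rightarrow> linf_pos"
    and "continuous_on linf_pos \<Gamma>"
    and "monotone_op \<Gamma>"
    and "subadditive_op \<Gamma>"
    and "homogeneous_op \<Gamma>"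
    and "ereal (norm (\<Gamma> ones)) < \<infinity>"
  shows "convergent (growth_seq \<Gamma>) \<and>
    (spectral_radius \<Gamma> < 1 \<longleftrightarrow> UGES \<Gamma>) \<and>
    (UGES \<Gamma> \<longleftrightarrow> UGAS \<Gamma>) \<and>
    (UGAS \<Gamma> \<longleftrightarrow> point_of_strict_decay \<Gamma>) \<and>
    (point_of_strict_decay \<Gamma> \<longleftrightarrow> (\<exists>n::nat. n \<ge> 1 \<and> norm ((\<Gamma> ^^ n) ones) < 1))"
proof -
  interpret monotone_homogeneous \<Gamma>
    using assms by unfold_locales
  have "convergent (growth_seq \<Gamma>)"
    using growth_seq_tendsto convergentI by blast
  moreover have "UGES \<Gamma> \<longleftrightarrow> (\<exists>n\<ge>1. ones_growth n < 1)"
    using UGES_if_ones_growth UGAS_if_UGES ones_growth_if_UGAS by blast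
  moreover have "UGAS \<Gamma> \<longleftrightarrow> (\<exists>n\<ge>1. ones_growth n < 1)"
    using UGES_if_ones_growth UGAS_if_UGES ones_growth_if_UGAS by blast
  moreover have "point_of_strict_decay \<Gamma> \<longleftrightarrow> (\<exists>n\<ge>1. ones_growth n < 1)"
    using strict_decay_if_ones_growth[OF \<open>subadditive_op \<Gamma>\<close>] ones_growth_if_strict_decay by blast
  ultimately show ?thesis
    using spectral_radius_less_1_iff by (simp add: ones_growth_def)
qed

end
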